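(* Let $\mathbf{H}$ be one of $\mathbf{Z}$, $\mathbf{N}$, $\mathbf{N}^+$, let $\mathscr{G}$ be a subset of the set of axioms $\mathscr{F}=\{\text{(F1)},\ldots,\text{(F5)}\}$, and let $q\in[1,\infty[$. Then $\mathcal{M}^\star(\mathscr{G})$ is a countably $q$-convex set.
   Context: $\mathbf{N}$ is the set of non-negative integers, $\mathbf{N}^+$ the set of positive integers, $\mathcal{P}(\mathbf{H})$ the power set of $\mathbf{H}$; $k\cdot X:=\{kx:x\in X\}$, $X+h:=\{x+h:x\in X\}$. Axioms for $\mu^\star:\mathcal{P}(\mathbf{H})\to\mathbf{R}$: (F1) $\mu^\star(\mathbf{H})=1$; (F2) $\mu^\star(X)\le\mu^\star(Y)$ whenever $X\subseteq Y\subseteq\mathbf{H}$; (F3) $\mu^\star(X\cup Y)\le\mu^\star(X)+\mu^\star(Y)$ for all $X,Y\subseteq\mathbf{H}$; (F4) $\mu^\star(k\cdot X)=\frac1k\mu^\star(X)$ for all $X\subseteq\mathbf{H}$, $k\in\mathbf{N}^+$; (F5) $\mu^\star(X+h)=\mu^\star(X)$ for all $X\subseteq\mathbf{H}$, $h\in\mathbf{N}$. $\mathcal{M}^\star(\mathscr{G})$ is the set of all functions $\mu^\star:\mathcal{P}(\mathbf{H})\to\mathbf{R}$ that satisfy all axioms in $\mathscr{G}$ and $\mathrm{Im}(\mu^\star)\subseteq[0,1]$. A set $\mathcal{F}$ of non-negative, uniformly bounded functions $\mathcal{P}(\mathbf{H})\to\mathbf{R}$ is countably $q$-convex if, for every $[0,1]$-valued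 sequence $(\alpha_n)_{n\ge1}$ with $\sum_{n=1}^\infty\alpha_n=1$ and every $\mathcal{F}$-valued sequence $(f_n)_{n\ge1}$, the function $f:\mathcal{P}(\mathbf{H})\to\mathbf{R}$, $X\mapsto\left(\sum_{n=1}^\infty\alpha_n(f_n(X))^q\right)^{1/q}$ belongs to $\mathcal{F}$. *)

theory Defs
  imports "HOL-Analysis.Analysis"
begin

text \<open>
  The ground set \<open>H\<close> is a set of integers. A function from the power set of \<open>H\<close> to the reals is
  an element of \<open>Pow H \<rightarrow>\<^sub>E UNIV\<close>: it is \<open>undefined\<close> outside \<open>Pow H\<close>, so that equality of
  such functions is equality on the subsets of \<open>H\<close>.
\<close>

definition dilate :: "nat \<Rightarrow> int set \<Rightarrow> int set" where
  "dilate k X = (\<lambda>x. int k * x) ` X"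

definition translate :: "int set \<Rightarrow> nat \<Rightarrow> int set" where
  "translate X h = (\<lambda>x. x + int h) ` X"

definition F1 :: "int set \<Rightarrow> (int set \<Rightarrow> real) \<Rightarrow> bool" where
  "F1 H \<mu> \<longleftrightarrow> \<mu> H = 1"

definition F2 :: "int set \<Rightarrow> (int set \<Rightarrow> real) \<Rightarrow> bool" where
  "F2 H \<mu> \<longleftrightarrow> (\<forall>X Y. X \<subseteq> Y \<and> Y \<subseteq> H \<longrightarrow> \<mu> X \<le> \<mu> Y)"

definition F3 :: "int set \<Rightarrow> (int set \<Rightarrow> real) \<Rightarrow> bool" where
  "F3 H \<mu> \<longleftrightarrow> (\<forall>X Y. X \<subseteq> H \<and> Y \<subseteq> H \<longrightarrow> \<mu> (X \<union> Y) \<le> \<mu> X + \<mu> Y)"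

definition F4 :: "int set \<Rightarrow> (int set \<Rightarrow> real) \<Rightarrow> bool" where
  "F4 H \<mu> \<longleftrightarrow> (\<forall>X k. X \<subseteq> H \<and> 1 \<le> k \<longrightarrow> \<mu> (dilate k X) = 1 / real k * \<mu> X)"

definition F5 :: "int set \<Rightarrow> (int set \<Rightarrow> real) \<Rightarrow> bool" where
  "F5 H \<mu> \<longleftrightarrow> (\<forall>X h. X \<subseteq> H \<longrightarrow> \<mu> (translate X h) = \<mu> X)"

definition M_star :: "int set \<Rightarrow> ((int set \<Rightarrow> real) \<Rightarrow> bool) set \<Rightarrow> (int set \<Rightarrow> real) set" where
  "M_star H G = {\<mu> \<in> Pow H \<rightarrow>\<^sub>E UNIV. (\<forall>A\<in>G. A \<mu>) \<and> \<mu> ` Pow H \<subseteq> {0..1}}"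

text \<open>
  Sequences are indexed from \<open>0\<close>. Only families of non-negative, uniformly bounded functions
  qualify, and on them the series below converges. Since \<open>0 powr a = 0\<close>, \<open>powr\<close> is the
  usual power on the non-negative reals for the exponents \<open>q \<ge> 1\<close> and \<open>1 / q\<close>.
\<close>

definition countably_q_convex :: "int set \<Rightarrow> real \<Rightarrow> (int set \<Rightarrow> real) set \<Rightarrow> bool" where
  "countably_q_convex H q F \<longleftrightarrow>
     F \<subseteq> (Pow H \<rightarrow>\<^sub>E UNIV) \<and>
     (\<forall>f\<in>F. \<forall>X\<in>Pow H. 0 \<le> f X) \<and>
     (\<exists>B. \<forall>f\<in>F. \<forall>X\<in>Pow H. f X \<le> B) \<and>
     (\<forall>(\<alpha> :: nat \<Rightarrow> real) (f :: nat \<Rightarrow> int set \<Rightarrow> real).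
        (\<forall>n. \<alpha> n \<in> {0..1}) \<and> \<alpha> sums 1 \<and> (\<forall>n. f n \<in> F) \<longrightarrow>
        (\<lambda>X\<in>Pow H. (\<Sum>n. \<alpha> n * f n X powr q) powr (1 / q)) \<in> F)"

end

theory Submission
  imports Defs
begin

text \<open>
  Each axiom only relates values of \<open>\<mu>\<close> on at most three sets, so the proposition reduces to
  properties of a single operation on bounded sequences, the weighted \<open>q\<close>-mean: applied at a set
  \<open>X\<close> to the values \<open>f\<^sub>0 X, f\<^sub>1 X, \<dots>\<close>, it yields the new value at \<open>X\<close>. Because the weights have
  total mass \<open>1\<close>, the mean fixes constant sequences, which gives (F1); it is monotone, which
  gives (F2) and the bound by \<open>1\<close>; it is positively homogeneous, which gives (F4); and (F5)
  holds because the two sequences to be averaged coincide.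

  Subadditivity (F3) follows from monotonicity and Minkowski's inequality for the weighted
  \<open>q\<close>-mean. The latter rests on the convexity of \<open>t \<mapsto> t powr q\<close>, which is where \<open>q \<ge> 1\<close> enters:
  when two sequences are divided by bounds \<open>x\<close> and \<open>y\<close> of their means, the results lie in the unit
  ball, and the sum of the two sequences divided by \<open>x + y\<close> is a convex combination of them.
\<close>

section \<open>Weighted means of order q\<close>

definition weighted_qmean :: "real \<Rightarrow> (nat \<Rightarrow> real) \<Rightarrow> (nat \<Rightarrow> real) \<Rightarrow> real" where
  "weighted_qmean q \<alpha> a = (\<Sum>n. \<alpha> n * a n powr q) powr (1 / q)"

text \<open>
  The sequences to be averaged take values in \<open>{0..1}\<close>, but in Minkowski's inequality their sums
  occur as well; hence an arbitrary bound \<open>C\<close>.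
\<close>

lemma summable_weighted_powr:
  fixes q C :: real
  assumes "summable \<alpha>" "\<And>n. 0 \<le> \<alpha> n" "\<And>n. 0 \<le> a n" "\<And>n. a n \<le> C" "0 \<le> q"
  shows "summable (\<lambda>n. \<alpha> n * a n powr q)"
proof (rule summable_comparison_test')
  show "summable (\<lambda>n. \<alpha> n * C powr q)"
    using assms(1) by (rule summable_mult2)
  show "norm (\<alpha> n * a n powr q) \<le> \<alpha> n * C powr q" if "n \<ge> 0" for n
    using assms by (simp add: abs_mult mult_left_mono powr_mono2)
qed

lemma weighted_qmean_mono:
  fixes q C :: real
  assumes "summable \<alpha>" "\<And>n. 0 \<le> \<alpha> n" "\<And>n. 0 \<le> a n" "\<And>n. a n \<le> b n" "\<And>n. b n \<le> C" "0 \<le> q"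
  shows "weighted_qmean q \<alpha> a \<le> weighted_qmean q \<alpha> b"
proof -
  have b0: "0 \<le> b n" and aC: "a n \<le> C" for n
    using assms(3-5)[of n] by linarith+
  have sa: "summable (\<lambda>n. \<alpha> n * a n powr q)"
    using assms aC by (intro summable_weighted_powr) auto
  have sb: "summable (\<lambda>n. \<alpha> n * b n powr q)"
    using assms b0 by (intro summable_weighted_powr) auto
  have "(\<Sum>n. \<alpha> n * a n powr q) \<le> (\<Sum>n. \<alpha> n * b n powr q)"
    using assms by (intro suminf_le sa sb) (auto intro!: mult_left_mono powr_mono2)
  moreover have "0 \<le> (\<Sum>n. \<alpha> n * a n powr q)"
    using assms by (intro suminf_nonneg sa) auto
  ultimately show ?thesis
    using assms(6) by (simp add: weighted_qmean_def powr_mono2)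
qed

lemma weighted_qmean_const:
  assumes "\<alpha> sums 1" "0 \<le> c" "0 < q"
  shows "weighted_qmean q \<alpha> (\<lambda>n. c) = c"
proof -
  have "(\<Sum>n. \<alpha> n * c powr q) = c powr q"
    using sums_mult2[OF assms(1), of "c powr q"] by (simp add: sums_iff)
  then show ?thesis
    using assms by (simp add: weighted_qmean_def powr_powr)
qed

lemma weighted_qmean_scale:
  fixes q C c :: real
  assumes "summable \<alpha>" "\<And>n. 0 \<le> \<alpha> n" "\<And>n. 0 \<le> a n" "\<And>n. a n \<le> C" "0 < q" "0 \<le> c"
  shows "weighted_qmean q \<alpha> (\<lambda>n. c * a n) = c * weighted_qmean q \<alpha> a"
proof -
  have s: "summable (\<lambda>n. \<alpha> n * a n powr q)"
    using assms by (intro summable_weighted_powr) auto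
  have "(\<Sum>n. \<alpha> n * (c * a n) powr q) = (\<Sum>n. c powr q * (\<alpha> n * a n powr q))"
    using assms by (simp add: powr_mult mult_ac)
  also have "\<dots> = c powr q * (\<Sum>n. \<alpha> n * a n powr q)"
    by (rule suminf_mult[OF s])
  finally show ?thesis
    using assms by (simp add: weighted_qmean_def powr_mult powr_powr suminf_nonneg s)
qed

section \<open>Minkowski's inequality\<close>

text \<open>
  The endpoint \<open>0\<close> is included because the averaged sequences may vanish; there convexity amounts
  to \<open>t powr q \<le> t\<close> for \<open>0 < t < 1\<close>.
\<close>

lemma convex_on_powr_nonneg:
  fixes q :: real
  assumes "1 \<le> q"
  shows "convex_on {0..} (\<lambda>t. t powr q)"
proof (rule convex_on_linorderI)
  fix t x y :: real
  assume t: "0 < t" "t < 1" and xy: "x \<in> {0..}" "y \<in> {0..}" "x < y"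
  show "((1 - t) *\<^sub>R x + t *\<^sub>R y) powr q \<le> (1 - t) * x powr q + t * y powr q"
  proof (cases "x = 0")
    case True
    have "t powr q \<le> t"
      using t assms powr_mono'[of 1 q t] by simp
    then show ?thesis
      using True t xy by (simp add: powr_mult mult_right_mono)
  next
    case False
    then show ?thesis
      using t xy assms by (intro convex_onD[OF powr_convex]) auto
  qed
qed simp

text \<open>
  By homogeneity, convexity of \<open>t powr q\<close> with weights \<open>x / (x + y)\<close> and \<open>y / (x + y)\<close> bounds the
  power of a sum in terms of the powers of the summands, for any positive \<open>x\<close> and \<open>y\<close>. This is
  linear in the powers of the summands, so it can be summed over the sequence.
\<close>

lemma powr_add_le_convex_combination:
  fixes q :: real
  assumes "1 \<le> q" "0 \<le> s" "0 \<le> t" "0 < x" "0 < y"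
  shows "(s + t) powr q \<le>
    (x + y) powr q * (x / (x + y) * (s powr q / x powr q) + y / (x + y) * (t powr q / y powr q))"
proof -
  have "((1 - y / (x + y)) *\<^sub>R (s / x) + (y / (x + y)) *\<^sub>R (t / y)) powr q
      \<le> (1 - y / (x + y)) * (s / x) powr q + (y / (x + y)) * (t / y) powr q"
    using assms by (intro convex_onD[OF convex_on_powr_nonneg]) auto
  moreover have w: "1 - y / (x + y) = x / (x + y)"
    using assms by (simp add: field_simps)
  moreover have "(x / (x + y)) *\<^sub>R (s / x) + (y / (x + y)) *\<^sub>R (t / y) = (s + t) / (x + y)"
    using assms by (simp add: add_divide_distrib)
  ultimately have "(s + t) powr q / (x + y) powr q
      \<le> x / (x + y) * (s powr q / x powr q) + y / (x + y) * (t powr q / y powr q)"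
    using assms by (simp add: powr_divide)
  then show ?thesis
    using assms by (simp add: divide_le_eq mult.commute)
qed

text \<open>
  Normalising by the means themselves would require separate treatment of vanishing means.
  Normalising by arbitrary strictly larger numbers, and letting these decrease to the means at
  the end, avoids it.
\<close>

lemma weighted_qmean_add_le:
  fixes q A B :: real
  assumes \<alpha>: "summable \<alpha>" "\<And>n. 0 \<le> \<alpha> n"
    and a: "\<And>n. 0 \<le> a n" "\<And>n. a n \<le> A"
    and b: "\<And>n. 0 \<le> b n" "\<And>n. b n \<le> B"
    and q: "1 \<le> q"
  shows "weighted_qmean q \<alpha> (\<lambda>n. a n + b n) \<le> weighted_qmean q \<alpha> a + weighted_qmean q \<alpha> b"
proof (rule field_le_epsilon)
  fix e :: real
  assume e: "0 < e"
  define x where "x = weighted_qmean q \<alpha> a + e / 2"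
  define y where "y = weighted_qmean q \<alpha> b + e / 2"
  define S where "S c = (\<Sum>n. \<alpha> n * c n powr q)" for c :: "nat \<Rightarrow> real"
  have sa: "summable (\<lambda>n. \<alpha> n * a n powr q)"
    using assms by (intro summable_weighted_powr) auto
  have sb: "summable (\<lambda>n. \<alpha> n * b n powr q)"
    using assms by (intro summable_weighted_powr) auto
  have sab: "summable (\<lambda>n. \<alpha> n * (a n + b n) powr q)"
    using assms by (intro summable_weighted_powr[where C = "A + B"]) (auto intro: add_mono)
  have S0: "0 \<le> S a" "0 \<le> S b" "0 \<le> S (\<lambda>n. a n + b n)"
    unfolding S_def using \<alpha> by (auto intro!: suminf_nonneg sa sb sab)
  have x: "0 < x" and y: "0 < y"
    using e by (auto simp: x_def y_def weighted_qmean_def intro: add_nonneg_pos)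
  have S_mean: "S c = weighted_qmean q \<alpha> c powr q" if "0 \<le> S c" for c
    using that q by (simp add: S_def weighted_qmean_def powr_powr)
  have Sa: "S a \<le> x powr q" and Sb: "S b \<le> y powr q"
    unfolding S_mean[OF S0(1)] S_mean[OF S0(2)] using q e
    by (auto simp: x_def y_def weighted_qmean_def intro!: powr_mono2)
  let ?K = "(x + y) powr q"
  let ?u = "?K * (x / (x + y) / x powr q)" and ?v = "?K * (y / (x + y) / y powr q)"
  have "S (\<lambda>n. a n + b n) \<le> (\<Sum>n. ?u * (\<alpha> n * a n powr q) + ?v * (\<alpha> n * b n powr q))"
    unfolding S_def
  proof (intro suminf_le sab summable_add summable_mult sa sb)
    fix n
    show "\<alpha> n * (a n + b n) powr q \<le> ?u * (\<alpha> n * a n powr q) + ?v * (\<alpha> n * b n powr q)"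
      using mult_left_mono[OF powr_add_le_convex_combination[OF q a(1) b(1) x y] \<alpha>(2), of n n n]
      by (simp add: algebra_simps)
  qed
  also have "\<dots> = ?u * S a + ?v * S b"
    unfolding S_def
    by (simp only: suminf_add[symmetric] suminf_mult summable_mult sa sb)
  also have "\<dots> \<le> ?u * x powr q + ?v * y powr q"
    using Sa Sb x y by (intro add_mono mult_left_mono) auto
  also have "\<dots> = ?K * (x / (x + y) + y / (x + y))"
    using x y by (simp add: distrib_left)
  also have "\<dots> = ?K"
    using x y by (simp flip: add_divide_distrib)
  finally have "S (\<lambda>n. a n + b n) powr (1 / q) \<le> ?K powr (1 / q)"
    using S0 q by (intro powr_mono2) auto
  also have "\<dots> = x + y"
    using x y q by (simp add: powr_powr)
  finally show "weighted_qmean q \<alpha> (\<lambda>n. a n + b n)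
      \<le> weighted_qmean q \<alpha> a + weighted_qmean q \<alpha> b + e"
    by (simp add: S_def weighted_qmean_def x_def y_def)
qed

section \<open>Countable convexity\<close>

text \<open>
  The axioms (F4) and (F5) speak of \<open>\<mu>\<close> at \<open>dilate k X\<close> and \<open>translate X h\<close>. A function that is
  given by its values on \<open>Pow H\<close> can be evaluated there only because these sets are again subsets
  of \<open>H\<close>, which comes from \<open>H\<close> being closed upwards.
\<close>

lemma mem_ground_set_upward:
  fixes x y :: int
  assumes "H \<in> {UNIV, {0..}, {1..}}" "x \<in> H" "x \<le> y"
  shows "y \<in> H"
  using assms by auto

lemma dilate_subset:
  assumes "H \<in> {UNIV, {0..}, {1..}}" "X \<subseteq> H" "1 \<le> k"
  shows "dilate k X \<subseteq> H"
proof -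
  have "int k * x \<in> H" if "x \<in> H" for x
  proof (cases "0 \<le> x")
    case True
    then have "x \<le> int k * x"
      using assms(3) mult_right_mono[of 1 "int k" x] by simp
    then show ?thesis
      by (rule mem_ground_set_upward[OF assms(1) that])
  next
    case False
    then have "H = UNIV"
      using assms(1) that by auto
    then show ?thesis
      by simp
  qed
  then show ?thesis
    using assms(2) by (auto simp: dilate_def)
qed

lemma translate_subset:
  assumes "H \<in> {UNIV, {0..}, {1..}}" "X \<subseteq> H"
  shows "translate X h \<subseteq> H"
  using assms(2) mem_ground_set_upward[OF assms(1)] by (auto simp: translate_def)

theorem proposition10:
  fixes H :: "int set" and G :: "((int set \<Rightarrow> real) \<Rightarrow> bool) set" and q :: real
  assumes "H \<in> {UNIV, {0..}, {1..}}"
    and "G \<subseteq> {F1 H, F2 H, F3 H, F4 H, F5 H}"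
    and "1 \<le> q"
  shows "countably_q_convex H q (M_star H G)"
proof -
  have mean_in: "(\<lambda>X\<in>Pow H. (\<Sum>n. \<alpha> n * f n X powr q) powr (1 / q)) \<in> M_star H G"
    if \<alpha>: "\<And>n. \<alpha> n \<in> {0..1}" "\<alpha> sums 1" and f: "\<And>n. f n \<in> M_star H G"
    for \<alpha> :: "nat \<Rightarrow> real" and f
  proof -
    define \<mu> where "\<mu> = (\<lambda>X\<in>Pow H. weighted_qmean q \<alpha> (\<lambda>n. f n X))"
    have \<mu>: "\<mu> X = weighted_qmean q \<alpha> (\<lambda>n. f n X)" if "X \<subseteq> H" for X
      using that by (simp add: \<mu>_def)
    have \<alpha>0: "0 \<le> \<alpha> n" for n
      using \<alpha>(1)[of n] by simp
    have s\<alpha>: "summable \<alpha>"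
      using \<alpha>(2) by (rule sums_summable)
    have f_ge: "0 \<le> f n X" and f_le: "f n X \<le> 1" if "X \<subseteq> H" for n X
      using f[of n] that by (auto simp: M_star_def image_subset_iff)
    have fG: "A (f n)" if "A \<in> G" for A n
      using f[of n] that by (auto simp: M_star_def)
    have G_cases: "A = F1 H \<or> A = F2 H \<or> A = F3 H \<or> A = F4 H \<or> A = F5 H" if "A \<in> G" for A
      using assms(2) that by blast
    have "A \<mu>" if "A \<in> G" for A
      using G_cases[OF that]
    proof (elim disjE)
      assume A: "A = F1 H"
      have "f n H = 1" for n
        using fG[OF that, of n] by (simp add: A F1_def)
      then show ?thesis
        using \<alpha> assms(3) by (simp add: A F1_def \<mu> weighted_qmean_const)
    next
      assume A: "A = F2 H"
      show ?thesis
        unfolding A F2_def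
      proof (intro allI impI, elim conjE)
        fix X Y
        assume XY: "X \<subseteq> Y" "Y \<subseteq> H"
        have "f n X \<le> f n Y" for n
          using fG[OF that, of n] XY by (auto simp: A F2_def)
        then have "weighted_qmean q \<alpha> (\<lambda>n. f n X) \<le> weighted_qmean q \<alpha> (\<lambda>n. f n Y)"
          using XY assms(3) s\<alpha> \<alpha>0 f_ge f_le by (intro weighted_qmean_mono[where C = 1]) auto
        then show "\<mu> X \<le> \<mu> Y"
          using XY by (simp add: \<mu>)
      qed
    next
      assume A: "A = F3 H"
      show ?thesis
        unfolding A F3_def
      proof (intro allI impI, elim conjE)
        fix X Y
        assume XY: "X \<subseteq> H" "Y \<subseteq> H"
        have "f n (X \<union> Y) \<le> f n X + f n Y" for n
          using fG[OF that, of n] XY by (auto simp: A F3_def)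
        moreover have "f n X + f n Y \<le> 1 + 1" for n
          using XY by (intro add_mono f_le)
        ultimately have "weighted_qmean q \<alpha> (\<lambda>n. f n (X \<union> Y)) \<le> weighted_qmean q \<alpha> (\<lambda>n. f n X + f n Y)"
          using XY assms(3) s\<alpha> \<alpha>0 f_ge
          by (intro weighted_qmean_mono[where C = "1 + 1"]) auto
        also have "\<dots> \<le> weighted_qmean q \<alpha> (\<lambda>n. f n X) + weighted_qmean q \<alpha> (\<lambda>n. f n Y)"
          using XY assms(3) s\<alpha> \<alpha>0 f_ge f_le
          by (intro weighted_qmean_add_le[where A = 1 and B = 1]) auto
        finally show "\<mu> (X \<union> Y) \<le> \<mu> X + \<mu> Y"
          using XY by (simp add: \<mu>)
      qed
    next
      assume A: "A = F4 H"
      show ?thesis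
        unfolding A F4_def
      proof (intro allI impI, elim conjE)
        fix X and k :: nat
        assume X: "X \<subseteq> H" and k: "1 \<le> k"
        have "f n (dilate k X) = 1 / real k * f n X" for n
          using fG[OF that, of n] X k by (auto simp: A F4_def)
        moreover have "weighted_qmean q \<alpha> (\<lambda>n. 1 / real k * f n X)
            = 1 / real k * weighted_qmean q \<alpha> (\<lambda>n. f n X)"
          using X assms(3) s\<alpha> \<alpha>0 f_ge f_le by (intro weighted_qmean_scale[where C = 1]) auto
        ultimately show "\<mu> (dilate k X) = 1 / real k * \<mu> X"
          using X dilate_subset[OF assms(1) X k] by (simp add: \<mu>)
      qed
    next
      assume A: "A = F5 H"
      show ?thesis
        unfolding A F5_def
      proof (intro allI impI)
        fix X h
        assume X: "X \<subseteq> H"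
        have "f n (translate X h) = f n X" for n
          using fG[OF that, of n] X by (auto simp: A F5_def)
        then show "\<mu> (translate X h) = \<mu> X"
          using X translate_subset[OF assms(1) X] by (simp add: \<mu>)
      qed
    qed
    moreover have "\<mu> X \<in> {0..1}" if "X \<subseteq> H" for X
    proof -
      have "weighted_qmean q \<alpha> (\<lambda>n. f n X) \<le> weighted_qmean q \<alpha> (\<lambda>n. 1)"
        using that assms(3) s\<alpha> \<alpha>0 f_ge f_le by (intro weighted_qmean_mono[where C = 1]) auto
      also have "\<dots> = 1"
        using \<alpha> assms(3) by (intro weighted_qmean_const) auto
      finally show ?thesis
        using that by (simp add: \<mu>) (simp add: weighted_qmean_def)
    qed
    ultimately have "\<mu> \<in> M_star H G"
      by (auto simp: M_star_def \<mu>_def)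
    then show ?thesis
      by (simp add: \<mu>_def weighted_qmean_def)
  qed
  have "M_star H G \<subseteq> (Pow H \<rightarrow>\<^sub>E UNIV)"
    by (auto simp: M_star_def)
  moreover have bounds: "0 \<le> f X \<and> f X \<le> 1" if "f \<in> M_star H G" "X \<in> Pow H" for f X
    using that by (auto simp: M_star_def image_subset_iff)
  moreover have "\<exists>B. \<forall>f\<in>M_star H G. \<forall>X\<in>Pow H. f X \<le> B"
    using bounds by (intro exI[of _ 1]) simp
  ultimately show ?thesis
    unfolding countably_q_convex_def by (simp add: mean_in)
qed

end
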